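(* Let $G$ be a finite simple Hamiltonian graph of order $n>3$ (i.e. $G$ has $n$ vertices and contains a cycle through every vertex), and let $\alpha$ be any magnetic potential on $G$. Then: (i) if $n$ is even, then $2\le\lambda_{\frac n2+1}(\Delta_\alpha^G)$ and $2<\lambda_{\frac n2+2}(\Delta_\alpha^G)$; (ii) if $n$ is odd, then $\lambda_{\frac{n+1}{2}+1}(\Delta_\alpha^G)>2$.
   Context: For a finite simple graph $G=(V,E)$ let $A$ be its set of arcs: each edge gives two oppositely oriented arcs $e,\bar e$; an arc $e$ has initial vertex $\partial_-e$ and terminal vertex $\partial_+e$; $A_v=\{e\in A : \partial_-e=v\}$ and $\deg(v)=|A_v|$. A magnetic potential on $G$ is a map $\alpha\colon A\to\mathbb{R}/2\pi\mathbb{Z}$ with $\alpha_{\bar e}=-\alpha_e$ for all $e\in A$. The discrete magnetic Laplacian is the operator $\Delta_\alpha^G$ on $\mathbb{C}^{V}$ (with its standard inner product) given by $(\Delta_\alpha^G\varphi)(v)=\deg(v)\varphi(v)-\sum_{e\in A_v}\mathrm{e}^{\mathrm{i}\alpha_e}\varphi(\partial_+e)$; it is self-adjoint and positive semidefinite. Its eigenvalues are written in ascending order, repeated according to multiplicity: $\lambda_1(\Delta_\alpha^G)\le\dots\le\lambda_n(\Delta_\alpha^G)$, $n=|V|$. *)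

theory Defs
  imports
    Complex_Main
    "HOL-Library.Function_Algebras"
    "HOL-Library.Real_Mod"
    "Graph_Theory.Graph_Theory"
begin

text \<open>
  A finite simple graph is an instance of the locale \<^locale>\<open>graph\<close>, in which every edge is
  represented by two oppositely oriented arcs.
\<close>

text \<open>
  In a symmetric digraph \<^const>\<open>pre_digraph.cycle\<close> also admits the closed walk of length two that
  runs back and forth along one edge; the length condition excludes it.
\<close>
definition hamiltonian :: "('a, 'b) pre_digraph \<Rightarrow> bool" where
  "hamiltonian G \<longleftrightarrow>
     (\<exists>p. pre_digraph.cycle G p \<and> 3 \<le> length p \<and> tail G ` set p = verts G)"

text \<open>
  A potential with values in the reals modulo \<open>2\<pi>\<close> is given by real representatives, with the
  antisymmetry condition holding modulo \<open>2\<pi>\<close>. In a simple graph the reverse of an arc is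
  determined by its end points.
\<close>
definition magnetic_potential :: "('a, 'b) pre_digraph \<Rightarrow> ('b \<Rightarrow> real) \<Rightarrow> bool" where
  "magnetic_potential G \<alpha> \<longleftrightarrow>
     (\<forall>e \<in> arcs G. \<forall>e' \<in> arcs G. tail G e' = head G e \<and> head G e' = tail G e \<longrightarrow>
        [\<alpha> e' = - \<alpha> e] (rmod (2 * pi)))"

definition magnetic_laplacian ::
    "('a, 'b) pre_digraph \<Rightarrow> ('b \<Rightarrow> real) \<Rightarrow> ('a \<Rightarrow> complex) \<Rightarrow> 'a \<Rightarrow> complex" where
  "magnetic_laplacian G \<alpha> \<phi> v =
     of_nat (out_degree G v) * \<phi> v
     - (\<Sum>e \<in> out_arcs G v. exp (\<i> * complex_of_real (\<alpha> e)) * \<phi> (head G e))"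

definition fun_scale :: "complex \<Rightarrow> ('a \<Rightarrow> complex) \<Rightarrow> 'a \<Rightarrow> complex" where
  "fun_scale c \<phi> = (\<lambda>v. c * \<phi> v)"

global_interpretation cfun: vector_space fun_scale
  by unfold_locales (auto simp: fun_scale_def fun_eq_iff algebra_simps)

text \<open>The space of complex functions on \<open>V\<close>, realised as functions vanishing outside \<open>V\<close>.\<close>
definition functions_on :: "'a set \<Rightarrow> ('a \<Rightarrow> complex) set" where
  "functions_on V = {\<phi>. \<forall>v. v \<notin> V \<longrightarrow> \<phi> v = 0}"

text \<open>
  Only real eigenvalues are considered: the magnetic Laplacian is self-adjoint, so there are no
  others, and the multiplicity of an eigenvalue is the dimension of its eigenspace.
\<close>
definition eigenspace ::
    "('a, 'b) pre_digraph \<Rightarrow> ('b \<Rightarrow> real) \<Rightarrow> real \<Rightarrow> ('a \<Rightarrow> complex) set" where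
  "eigenspace G \<alpha> x =
     {\<phi> \<in> functions_on (verts G). magnetic_laplacian G \<alpha> \<phi> = fun_scale (complex_of_real x) \<phi>}"

definition eigenvalues :: "('a, 'b) pre_digraph \<Rightarrow> ('b \<Rightarrow> real) \<Rightarrow> real set" where
  "eigenvalues G \<alpha> = {x. \<exists>\<phi> \<in> eigenspace G \<alpha> x. \<phi> \<noteq> 0}"

definition spectrum_list :: "('a, 'b) pre_digraph \<Rightarrow> ('b \<Rightarrow> real) \<Rightarrow> real list" where
  "spectrum_list G \<alpha> =
     concat (map (\<lambda>x. replicate (cfun.dim (eigenspace G \<alpha> x)) x)
       (sorted_list_of_set (eigenvalues G \<alpha>)))"

text \<open>
  The \<open>k\<close>-th smallest eigenvalue, counted from \<open>k = 1\<close>; meaningful for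
  \<open>1 \<le> k \<le> card (verts G)\<close>.
\<close>
definition eigval :: "nat \<Rightarrow> ('a, 'b) pre_digraph \<Rightarrow> ('b \<Rightarrow> real) \<Rightarrow> real" where
  "eigval k G \<alpha> = spectrum_list G \<alpha> ! (k - 1)"

end

theory Submission
  imports Defs "HOL-Computational_Algebra.Fundamental_Theorem_Algebra"
begin

text \<open>
  Let \<open>U\<close> be spanned by the eigenvectors with eigenvalue at most 2, and let \<open>Z\<close> be the functions
  supported on a set \<open>I\<close> of vertices no two of which are consecutive on the Hamiltonian cycle. The
  quadratic form of the Laplacian is a sum over edges, so dropping the chords of the cycle can only
  decrease it; on \<open>Z\<close> the cycle alone contributes exactly twice the squared norm. A function in
  \<open>U \<inter> Z\<close> is therefore an eigenvector for 2 to which the chords contribute nothing, and then the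
  eigenvalue equation at a vertex outside \<open>I\<close> makes it vanish at one cycle neighbour as soon as it
  vanishes at the other. If \<open>I\<close> consists of every second vertex, starting from the third one, there
  are two consecutive zeros to start from, so \<open>U \<inter> Z = 0\<close>, which bounds \<open>dim U\<close> by \<open>n - card I\<close>. For
  eigenvalues strictly below 2 and \<open>n\<close> even, all of one colour class of the cycle can serve as \<open>I\<close>.
\<close>

section \<open>Self-adjoint operators on a finite-dimensional function space\<close>

definition inner_on :: "'a set \<Rightarrow> ('a \<Rightarrow> complex) \<Rightarrow> ('a \<Rightarrow> complex) \<Rightarrow> complex" where
  "inner_on V \<phi> \<psi> = (\<Sum>v\<in>V. \<phi> v * cnj (\<psi> v))"

lemma fun_scale_apply [simp]: "fun_scale c \<phi> v = c * \<phi> v"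
  by (simp add: fun_scale_def)

lemma inner_on_simps:
  "inner_on V 0 \<psi> = 0" "inner_on V \<phi> 0 = 0"
  "inner_on V (\<phi> + \<phi>') \<psi> = inner_on V \<phi> \<psi> + inner_on V \<phi>' \<psi>"
  "inner_on V \<phi> (\<psi> + \<psi>') = inner_on V \<phi> \<psi> + inner_on V \<phi> \<psi>'"
  "inner_on V (\<phi> - \<phi>') \<psi> = inner_on V \<phi> \<psi> - inner_on V \<phi>' \<psi>"
  "inner_on V \<phi> (\<psi> - \<psi>') = inner_on V \<phi> \<psi> - inner_on V \<phi> \<psi>'"
  "inner_on V (fun_scale c \<phi>) \<psi> = c * inner_on V \<phi> \<psi>"
  "inner_on V \<phi> (fun_scale c \<psi>) = cnj c * inner_on V \<phi> \<psi>"
  by (simp_all add: inner_on_def sum.distrib sum_subtractf sum_distrib_left algebra_simps)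

lemma inner_on_sum_left: "inner_on V (sum f A) \<psi> = (\<Sum>a\<in>A. inner_on V (f a) \<psi>)"
  by (induction A rule: infinite_finite_induct)
    (simp_all add: inner_on_simps del: zero_fun_apply plus_fun_apply)

lemma inner_on_sum_right: "inner_on V \<phi> (sum f A) = (\<Sum>a\<in>A. inner_on V \<phi> (f a))"
  by (induction A rule: infinite_finite_induct)
    (simp_all add: inner_on_simps del: zero_fun_apply plus_fun_apply)

lemma inner_on_self: "inner_on V \<phi> \<phi> = complex_of_real (\<Sum>v\<in>V. (cmod (\<phi> v))\<^sup>2)"
  by (simp add: inner_on_def complex_norm_square [symmetric])

lemma Re_inner_on_self_nonneg: "Re (inner_on V \<phi> \<phi>) \<ge> 0"
  by (simp add: inner_on_self sum_nonneg)

lemma inner_on_self_eq_0: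
  assumes "finite V" "\<phi> \<in> functions_on V" "Re (inner_on V \<phi> \<phi>) = 0"
  shows "\<phi> = 0"
proof
  fix v
  have "(\<Sum>v\<in>V. (cmod (\<phi> v))\<^sup>2) = 0"
    using assms(3) by (simp add: inner_on_self)
  with assms(1) have "\<forall>v\<in>V. (cmod (\<phi> v))\<^sup>2 = 0"
    by (subst (asm) sum_nonneg_eq_0_iff) auto
  with assms(2) show "\<phi> v = 0 v"
    by (cases "v \<in> V") (auto simp: functions_on_def)
qed

lemma subspace_functions_on: "cfun.subspace (functions_on V)"
  by (rule cfun.subspaceI) (auto simp: functions_on_def)

section \<open>Point masses and the dimension of the function space\<close>

definition point_mass :: "'a \<Rightarrow> 'a \<Rightarrow> complex" where
  "point_mass v = (\<lambda>w. if w = v then 1 else 0)"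

lemma functions_on_subset_span:
  assumes "finite V"
  shows "functions_on V \<subseteq> cfun.span (point_mass ` V)"
proof
  fix \<phi> assume \<phi>: "\<phi> \<in> functions_on V"
  have sum_apply: "sum f V w = (\<Sum>v\<in>V. f v w)" for f :: "'a \<Rightarrow> 'a \<Rightarrow> complex" and w
    by (induction V rule: infinite_finite_induct) auto
  have "\<phi> = (\<Sum>v\<in>V. fun_scale (\<phi> v) (point_mass v))"
    using \<phi> assms
    by (auto simp: fun_eq_iff point_mass_def functions_on_def sum_apply if_distrib sum.delta
      cong: if_cong)
  also have "\<dots> \<in> cfun.span (point_mass ` V)"
    by (intro cfun.span_sum cfun.span_scale cfun.span_base) auto
  finally show "\<phi> \<in> cfun.span (point_mass ` V)" .
qed

lemma independent_functions_on:
  assumes "finite V" "cfun.independent B" "B \<subseteq> functions_on V"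
  shows "finite B \<and> card B \<le> card V"
proof -
  have "B \<subseteq> cfun.span (point_mass ` V)"
    using assms functions_on_subset_span by blast
  then have "finite B \<and> card B \<le> card (point_mass ` V)"
    using assms by (intro cfun.independent_span_bound) auto
  then show ?thesis
    using card_image_le [OF assms(1), of point_mass] by simp
qed

lemma dim_functions_on:
  assumes "finite V"
  shows "cfun.dim (functions_on V) = card V"
proof -
  have inj: "inj_on point_mass V"
    by (rule inj_onI) (metis point_mass_def zero_neq_one)
  have "cfun.independent (point_mass ` V)"
  proof (rule cfun.independent_if_scalars_zero)
    fix f :: "('a \<Rightarrow> complex) \<Rightarrow> complex" and x
    assume *: "(\<Sum>x\<in>point_mass ` V. fun_scale (f x) x) = 0" and "x \<in> point_mass ` V"
    then obtain v where v: "v \<in> V" "x = point_mass v" by auto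
    \<comment> \<open>The inner product over the single point \<open>v\<close> against
      \<open>point_mass v\<close> is evaluation at \<open>v\<close>, which isolates one coefficient
      of the relation.\<close>
    have "inner_on {v} (\<Sum>x\<in>point_mass ` V. fun_scale (f x) x) (point_mass v) = f (point_mass v)"
      unfolding inner_on_sum_left sum.reindex [OF inj]
      using v assms 
      by (auto simp: inner_on_def point_mass_def if_distrib if_distribR sum.delta cong: if_cong)
    then show "f x = 0"
      using v * by (simp add: inner_on_simps)
  qed (use assms in auto)
  then have "card (point_mass ` V) = cfun.dim (functions_on V)"
    using functions_on_subset_span [OF assms]
    by (intro cfun.basis_card_eq_dim) (auto simp: point_mass_def functions_on_def)
  then show ?thesis
    by (simp add: card_image [OF inj])
qed

text \<open>There are \<open>card V + 1\<close> functions, more than the dimension. Linear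
  dependence is a notion for sets, so a family with repetitions is a case of its own.\<close>

lemma nontrivial_relation:
  fixes g :: "nat \<Rightarrow> 'a \<Rightarrow> complex"
  assumes "finite V" and "\<And>i. g i \<in> functions_on V"
  obtains f where "\<exists>i\<le>card V. f i \<noteq> 0" "(\<Sum>i\<le>card V. fun_scale (f i) (g i)) = 0"
proof (cases "inj_on g {..card V}")
  case True
  then have "\<not> card (g ` {..card V}) \<le> card V"
    by (simp add: card_image)
  then have "cfun.dependent (g ` {..card V})"
    using independent_functions_on [OF assms(1), of "g ` {..card V}"] assms(2) by blast
  then obtain u where u: "\<exists>x\<in>g ` {..card V}. u x \<noteq> 0"
      "(\<Sum>x\<in>g ` {..card V}. fun_scale (u x) x) = 0"
    by (auto simp: cfun.dependent_finite)
  show thesis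
    by (rule that [of "u \<circ> g"]) (use u True in \<open>auto simp: sum.reindex\<close>)
next
  case False
  then obtain i j where ij: "i \<le> card V" "j \<le> card V" "i \<noteq> j" "g i = g j"
    by (auto simp: inj_on_def)
  \<comment> \<open>The repeated value gives the relation \<open>g i - g j = 0\<close>.\<close>
  define f where "f = (\<lambda>k. if k = i then 1 else if k = j then -1 else (0::complex))"
  have "(\<Sum>k\<le>card V. fun_scale (f k) (g k)) = (\<Sum>k\<in>{i, j}. fun_scale (f k) (g k))"
    using ij by (intro sum.mono_neutral_right) (auto simp: f_def)
  also have "\<dots> = 0"
    using ij by (auto simp: f_def fun_eq_iff)
  finally show thesis
    using ij by (intro that [of f]) (auto simp: f_def)
qed

text \<open>Linearity and symmetry are demanded for all functions, not just those supported on
  \<open>V\<close>, which avoids side conditions. The magnetic Laplacian satisfies this because it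
  only reads values at vertices.\<close>

locale self_adjoint_operator =
  fixes V :: "'a set" and T :: "('a \<Rightarrow> complex) \<Rightarrow> 'a \<Rightarrow> complex"
  assumes finite_V: "finite V"
    and T_add: "T (\<phi> + \<psi>) = T \<phi> + T \<psi>"
    and T_scale: "T (fun_scale c \<phi>) = fun_scale c (T \<phi>)"
    and T_closed: "\<phi> \<in> functions_on V \<Longrightarrow> T \<phi> \<in> functions_on V"
    and self_adjoint: "inner_on V (T \<phi>) \<psi> = inner_on V \<phi> (T \<psi>)"
begin

definition E :: "real \<Rightarrow> ('a \<Rightarrow> complex) set" where
  "E x = {\<phi> \<in> functions_on V. T \<phi> = fun_scale (complex_of_real x) \<phi>}"

lemma T_0: "T 0 = 0"
  using T_scale [of 0 0] by (simp add: fun_scale_def zero_fun_def)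

lemma T_sum: "T (sum f A) = (\<Sum>a\<in>A. T (f a))"
  by (induction A rule: infinite_finite_induct) (simp_all add: T_0 T_add del: zero_fun_apply plus_fun_apply)

lemma T_diff: "T (\<phi> - \<psi>) = T \<phi> - T \<psi>"
  using T_add [of "\<phi> - \<psi>" \<psi>] by (simp add: algebra_simps)

lemma subspace_E: "cfun.subspace (E x)"
  using subspace_functions_on [of V]
  by (auto simp: cfun.subspace_def E_def T_0 T_add T_scale fun_eq_iff algebra_simps)

lemma E_functions_on: "E x \<subseteq> functions_on V"
  by (auto simp: E_def)

text \<open>Symmetry gives \<open>c * <phi, phi> = cnj c * <phi, phi>\<close>. The scalar is complex
  because it will be a root supplied by the fundamental theorem of algebra, whereas \<open>E\<close>
  is indexed by reals.\<close>

lemma eigenvalue_real: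
  assumes "\<phi> \<in> functions_on V" "\<phi> \<noteq> 0" "T \<phi> = fun_scale c \<phi>"
  shows "c = complex_of_real (Re c)"
proof -
  have "c * inner_on V \<phi> \<phi> = cnj c * inner_on V \<phi> \<phi>"
    using self_adjoint [of \<phi> \<phi>] assms(3) by (simp add: inner_on_simps)
  moreover have "inner_on V \<phi> \<phi> \<noteq> 0"
    using inner_on_self_eq_0 [OF finite_V assms(1)] assms(2) by force
  ultimately have "c = cnj c"
    by simp
  then show ?thesis
    by (simp add: complex_eq_iff)
qed

lemma E_orthogonal:
  assumes "\<phi> \<in> E x" "\<psi> \<in> E y" "x \<noteq> y"
  shows "inner_on V \<phi> \<psi> = 0"
  using self_adjoint [of \<phi> \<psi>] assms by (auto simp: E_def inner_on_simps)

text \<open>Semisimplicity: \<open>T - c\<close> and its square have the same kernel. If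
  \<open>w\<close> were nonzero, \<open>c\<close> would be real and
  \<open><w, w> = <(T - c) u, w> = <u, (T - c) w> = 0\<close>.\<close>

lemma kernel_square:
  assumes "u \<in> functions_on V" and w: "w = T u - fun_scale c u" "T w = fun_scale c w"
  shows "w = 0"
proof (rule ccontr)
  assume "w \<noteq> 0"
  have "w \<in> functions_on V"
    using assms(1) T_closed [OF assms(1)] by (auto simp: w functions_on_def)
  with eigenvalue_real \<open>w \<noteq> 0\<close> w(2) have c: "cnj c = c"
    by (metis complex_cnj_complex_of_real)
  have "inner_on V w w = inner_on V (T u) w - c * inner_on V u w"
    by (subst w(1)) (simp add: inner_on_simps)
  also have "\<dots> = 0"
    using c by (simp add: self_adjoint w(2) inner_on_simps)
  finally show False
    using inner_on_self_eq_0 [OF finite_V \<open>w \<in> functions_on V\<close>] \<open>w \<noteq> 0\<close> by simp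
qed

text \<open>Contributions to the same eigenvalue merge because each \<open>E x\<close> is a
  subspace. Having \<open>g x\<close> in \<open>E x\<close> also for \<open>x\<close> outside
  \<open>Y\<close> spares membership conditions later.\<close>

lemma span_E_decomposition:
  assumes "\<phi> \<in> cfun.span (\<Union>x\<in>X. E x)"
  obtains Y g where "finite Y" "Y \<subseteq> X" "\<And>x. g x \<in> E x" "\<phi> = (\<Sum>x\<in>Y. g x)"
proof -
  have "\<exists>Y g. finite Y \<and> Y \<subseteq> X \<and> (\<forall>x. g x \<in> E x) \<and> \<phi> = (\<Sum>x\<in>Y. g x)"
    using assms
  proof (induction rule: cfun.span_induct_alt)
    case base
    show ?case
      using subspace_E by (intro exI [of _ "{}"] exI [of _ "\<lambda>_. 0"])
        (simp add: cfun.subspace_0 del: zero_fun_apply)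
  next
    case (step c b \<psi>)
    then obtain Y g x where *: "finite Y" "Y \<subseteq> X" "\<And>x. g x \<in> E x" "\<psi> = (\<Sum>x\<in>Y. g x)"
      "x \<in> X" "b \<in> E x" by blast
    \<comment> \<open>Padding by 0 lets the new vector be added at \<open>x\<close> whether or not
      \<open>x\<close> already belongs to \<open>Y\<close>.\<close>
    define h where "h = (\<lambda>y. if y \<in> Y then g y else 0)"
    have h: "h y \<in> E y" for y
      using *(3) subspace_E by (auto simp: h_def cfun.subspace_def)
    have "\<psi> = (\<Sum>y\<in>insert x Y. h y)"
      unfolding *(4) using *(1) by (intro sum.mono_neutral_cong_left) (auto simp: h_def)
    then have "fun_scale c b + \<psi> = (\<Sum>y\<in>insert x Y. (h(x := fun_scale c b + h x)) y)"
      using *(1) by (simp add: sum.insert_remove algebra_simps)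
    moreover have "(h(x := fun_scale c b + h x)) y \<in> E y" for y
      using h *(6) subspace_E by (auto simp: cfun.subspace_def)
    ultimately show ?case
      using * by (intro exI [of _ "insert x Y"] exI [of _ "h(x := fun_scale c b + h x)"]) auto
  qed
  then show thesis using that by blast
qed

text \<open>
  In other words, \<open>T - c\<close> is injective modulo the span of the eigenvectors. Splitting an annihilating
  polynomial into linear factors then shows that the eigenvectors span everything.
\<close>
lemma span_E_saturated:
  assumes u: "u \<in> functions_on V" and span: "T u - fun_scale c u \<in> cfun.span (\<Union>x. E x)"
  shows "u \<in> cfun.span (\<Union>x. E x)"
proof -
  obtain Y g where Y: "finite Y" and g: "\<And>x. g x \<in> E x"
    and eq: "T u - fun_scale c u = (\<Sum>x\<in>Y. g x)"
    using span_E_decomposition [OF span] by metis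
  \<comment> \<open>the summand of \<open>s\<close> with \<open>x = c\<close>, if any, is 0 because \<open>1 / 0 = 0\<close>\<close>
  define s where "s = (\<Sum>x\<in>Y. fun_scale (1 / (complex_of_real x - c)) (g x))"
  have "s \<in> cfun.span (\<Union>x. E x)"
    unfolding s_def using g by (intro cfun.span_sum cfun.span_scale cfun.span_base) auto
  then have "s \<in> functions_on V"
    using cfun.span_minimal [OF _ subspace_functions_on, of "\<Union>x. E x" V] E_functions_on by blast
  \<comment> \<open>\<open>r\<close> is the component for \<open>c\<close>, the part that
    \<open>s\<close> cannot produce: \<open>T - c\<close> maps \<open>s\<close> to the sum of all
    other summands. Hence \<open>r = (T - c) (u - s)\<close> while \<open>(T - c) r = 0\<close>, and
    \<open>kernel_square\<close> applies.\<close>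
  define r where "r = (\<Sum>x\<in>{x\<in>Y. complex_of_real x = c}. g x)"
  have Tr: "T r = fun_scale c r"
    unfolding r_def T_sum cfun.scale_sum_right using g by (intro sum.cong) (auto simp: E_def)
  have "T s - fun_scale c s = (\<Sum>x\<in>Y. if complex_of_real x = c then 0 else g x)"
    unfolding s_def T_sum cfun.scale_sum_right sum_subtractf [symmetric]
    using g by (intro sum.cong refl) (auto simp: E_def T_scale fun_eq_iff field_simps)
  moreover have "r = (\<Sum>x\<in>Y. if complex_of_real x = c then g x else 0)"
    unfolding r_def using Y by (simp add: sum.inter_filter)
  ultimately have "T s - fun_scale c s + r = (\<Sum>x\<in>Y. g x)"
    by (simp add: sum.distrib [symmetric] if_distrib if_distribR cong: if_cong)
  then have r: "r = T (u - s) - fun_scale c (u - s)"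
    using eq by (auto simp: T_diff cfun.scale_right_diff_distrib algebra_simps)
  have us: "u - s \<in> functions_on V"
    using u \<open>s \<in> functions_on V\<close> subspace_functions_on cfun.subspace_diff by blast
  then have "r = 0"
    using kernel_square r Tr by blast
  then have T_us: "T (u - s) = fun_scale c (u - s)"
    using r by simp
  \<comment> \<open>The zero function is treated apart, since then \<open>c\<close> need not be real
    and no \<open>E x\<close> corresponds to it.\<close>
  have "u - s \<in> cfun.span (\<Union>x. E x)"
  proof (cases "u - s = 0")
    case True
    then show ?thesis by (metis cfun.span_zero)
  next
    case False
    with us T_us eigenvalue_real have "u - s \<in> E (Re c)"
      unfolding E_def by force
    then show ?thesis by (auto intro: cfun.span_base)
  qed
  from cfun.span_add [OF this \<open>s \<in> cfun.span _\<close>] show ?thesis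
    by simp
qed

section \<open>Polynomials in the operator\<close>

definition poly_op :: "complex poly \<Rightarrow> ('a \<Rightarrow> complex) \<Rightarrow> 'a \<Rightarrow> complex" where
  "poly_op p \<phi> = (\<Sum>i\<le>degree p. fun_scale (coeff p i) ((T ^^ i) \<phi>))"

text \<open>Coefficients above the degree vanish, so sums for polynomials of different degrees can
  share one range.\<close>

lemma poly_op_bound:
  assumes "degree p \<le> N"
  shows "poly_op p \<phi> = (\<Sum>i\<le>N. fun_scale (coeff p i) ((T ^^ i) \<phi>))"
  unfolding poly_op_def using assms
  by (intro sum.mono_neutral_left) (auto simp: coeff_eq_0 not_le)

lemma poly_op_linear_factor:
  "poly_op ([:-c, 1:] * q) \<phi> = T (poly_op q \<phi>) - fun_scale c (poly_op q \<phi>)"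
proof -
  let ?N = "Suc (degree q)"
  have "degree ([:-c, 1:] * q) \<le> ?N"
    by (rule order_trans [OF degree_mult_le]) simp
  \<comment> \<open>\<open>pCons 0 q\<close> is \<open>X * q\<close>, so the coefficients of
    \<open>(X - c) * q\<close> split into those of \<open>X * q\<close> and of
    \<open>c * q\<close>.\<close>
  then have "poly_op ([:-c, 1:] * q) \<phi>
      = (\<Sum>i\<le>?N. fun_scale (coeff (pCons 0 q) i) ((T ^^ i) \<phi>) - fun_scale c (fun_scale (coeff q i) ((T ^^ i) \<phi>)))"
    by (subst poly_op_bound [of _ ?N], assumption, intro sum.cong) (auto simp: fun_eq_iff algebra_simps)
  also have "\<dots> = (\<Sum>i\<le>?N. fun_scale (coeff (pCons 0 q) i) ((T ^^ i) \<phi>))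
      - fun_scale c (poly_op q \<phi>)"
    by (simp only: sum_subtractf cfun.scale_sum_right poly_op_bound [of q ?N] le_SucI order_refl)
  \<comment> \<open>Multiplication by \<open>X\<close> shifts the coefficients: the term at 0
    vanishes and the others carry one more factor \<open>T\<close>.\<close>
  also have "(\<Sum>i\<le>?N. fun_scale (coeff (pCons 0 q) i) ((T ^^ i) \<phi>)) = T (poly_op q \<phi>)"
    by (subst sum.atMost_Suc_shift) (simp add: poly_op_def T_sum T_scale)
  finally show ?thesis .
qed

lemma poly_op_closed: "\<phi> \<in> functions_on V \<Longrightarrow> poly_op p \<phi> \<in> functions_on V"
proof -
  assume "\<phi> \<in> functions_on V"
  then have "(T ^^ i) \<phi> \<in> functions_on V" for i
    by (induction i) (auto intro: T_closed)
  then show ?thesis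
    unfolding poly_op_def
    by (intro cfun.subspace_sum cfun.subspace_scale subspace_functions_on)
qed

text \<open>Induction on the degree: for a root \<open>c\<close> of \<open>p = (X - c) * q\<close>,
  \<open>span_E_saturated\<close> removes the factor \<open>T - c\<close> and leaves
  \<open>q\<close>. A nonzero constant is divided out at the end.\<close>

lemma poly_op_in_span_E:
  assumes "\<phi> \<in> functions_on V" "p \<noteq> 0" "poly_op p \<phi> \<in> cfun.span (\<Union>x. E x)"
  shows "\<phi> \<in> cfun.span (\<Union>x. E x)"
  using assms(2,3)
proof (induction "degree p" arbitrary: p)
  case 0
  then obtain a where p: "p = [:a:]" "a \<noteq> 0"
    by (metis degree_eq_zeroE pCons_0_0)
  then have "fun_scale (1 / a) (poly_op p \<phi>) = \<phi>"
    by (simp add: poly_op_def fun_eq_iff)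
  with 0 show ?case
    by (metis cfun.span_scale)
next
  case (Suc n)
  then have "\<not> constant (poly p)"
    by (simp add: constant_degree)
  then obtain c where "poly p c = 0"
    using fundamental_theorem_of_algebra by blast
  then obtain q where q: "p = [:-c, 1:] * q"
    by (auto simp: poly_eq_0_iff_dvd)
  with Suc have "q \<noteq> 0" "degree q = n"
    by (auto simp del: mult_pCons_left simp: degree_mult_eq)
  moreover have "poly_op q \<phi> \<in> cfun.span (\<Union>x. E x)"
    using Suc.prems(2) unfolding q poly_op_linear_factor
    by (rule span_E_saturated [OF poly_op_closed [OF assms(1)]])
  ultimately show ?case
    using Suc.hyps(1) by blast
qed

text \<open>The vectors \<open>(T ^^ i) \<phi>\<close> with \<open>i \<le> card V\<close> are too
  many to be independent. A relation among them is a nonzero polynomial annihilating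
  \<open>\<phi>\<close>, and 0 lies in the span.\<close>

theorem span_E: "cfun.span (\<Union>x. E x) = functions_on V"
proof
  show "cfun.span (\<Union>x. E x) \<subseteq> functions_on V"
    using E_functions_on by (intro cfun.span_minimal subspace_functions_on) auto
  show "functions_on V \<subseteq> cfun.span (\<Union>x. E x)"
  proof
    fix \<phi> assume \<phi>: "\<phi> \<in> functions_on V"
    then have "(T ^^ i) \<phi> \<in> functions_on V" for i
      by (induction i) (auto intro: T_closed)
    then obtain f where f: "\<exists>i\<le>card V. f i \<noteq> 0" "(\<Sum>i\<le>card V. fun_scale (f i) ((T ^^ i) \<phi>)) = 0"
      using nontrivial_relation [OF finite_V, of "\<lambda>i. (T ^^ i) \<phi>"] by blast
    define p where "p = (\<Sum>i\<le>card V. monom (f i) i)"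
    have coeff: "coeff p i = (if i \<le> card V then f i else 0)" for i
      by (simp add: p_def coeff_sum sum.delta)
    then have "degree p \<le> card V"
      by (intro degree_le) auto
    then have "poly_op p \<phi> = 0"
      using f(2) by (simp add: poly_op_bound [of p "card V"] coeff)
    moreover have "p \<noteq> 0"
      using f(1) coeff by (metis coeff_0)
    ultimately show "\<phi> \<in> cfun.span (\<Union>x. E x)"
      using poly_op_in_span_E [OF \<phi>] cfun.span_zero by metis
  qed
qed

section \<open>Eigenbases and dimension counts\<close>

lemma span_E_basis:
  assumes "finite X"
  obtains B where "cfun.independent B" "finite B"
    "cfun.span B = cfun.span (\<Union>x\<in>X. E x)" "card B = (\<Sum>x\<in>X. cfun.dim (E x))"
proof -
  have "\<exists>b. b \<subseteq> E x \<and> cfun.independent b \<and> E x \<subseteq> cfun.span b \<and> card b = cfun.dim (E x)" for x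
    by (rule cfun.basis_exists [of "E x"]) auto
  then obtain b where b: "\<And>x. b x \<subseteq> E x" "\<And>x. cfun.independent (b x)"
      "\<And>x. E x \<subseteq> cfun.span (b x)" "\<And>x. card (b x) = cfun.dim (E x)"
    by metis
  have fin: "finite (b x)" for x
    using independent_functions_on [OF finite_V b(2)] b(1) E_functions_on by blast
  \<comment> \<open>A common vector of two eigenspaces is orthogonal to itself, hence 0, which no
    independent set contains.\<close>
  have disj: "b x \<inter> b y = {}" if "x \<noteq> y" for x y
  proof (rule ccontr)
    assume "b x \<inter> b y \<noteq> {}"
    then obtain \<phi> where "\<phi> \<in> b x" "\<phi> \<in> b y" by blast
    then have \<phi>: "\<phi> \<in> E x" "\<phi> \<in> E y" using b(1) by auto
    have "inner_on V \<phi> \<phi> = 0"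
      using E_orthogonal [OF \<phi> that] .
    then have "\<phi> = 0"
      using \<phi> E_functions_on by (intro inner_on_self_eq_0 [OF finite_V]) auto
    then show False
      using \<open>\<phi> \<in> b x\<close> b(2) cfun.dependent_zero by metis
  qed
  have "cfun.independent (\<Union>x\<in>X. b x)"
  proof (rule cfun.independent_if_scalars_zero)
    fix f \<psi> assume *: "(\<Sum>\<phi>\<in>(\<Union>x\<in>X. b x). fun_scale (f \<phi>) \<phi>) = 0" and "\<psi> \<in> (\<Union>x\<in>X. b x)"
    then obtain y where y: "y \<in> X" "\<psi> \<in> b y" by blast
    define g where "g x = (\<Sum>\<phi>\<in>b x. fun_scale (f \<phi>) \<phi>)" for x
    have g: "g x \<in> E x" for x
      unfolding g_def using b(1)
      by (intro cfun.subspace_sum cfun.subspace_scale subspace_E) auto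
    have "(\<Sum>x\<in>X. g x) = 0"
      using * disj unfolding g_def by (subst (asm) sum.UNION_disjoint) (auto simp: assms fin)
    \<comment> \<open>Pairing the relation with its component \<open>g y\<close> kills all other
      components by orthogonality.\<close>
    then have "0 = (\<Sum>x\<in>X. inner_on V (g x) (g y))"
      by (simp add: inner_on_sum_left [symmetric] inner_on_simps del: zero_fun_apply)
    also have "\<dots> = (\<Sum>x\<in>{y}. inner_on V (g x) (g y))"
      using E_orthogonal [OF g g] y(1) assms by (intro sum.mono_neutral_right) auto
    finally have "g y = 0"
      using g E_functions_on by (intro inner_on_self_eq_0 [OF finite_V]) auto
    then show "f \<psi> = 0"
      using cfun.independentD [OF b(2) fin order_refl] y(2) unfolding g_def by metis
  qed (use assms fin in auto)
  moreover have "cfun.span (\<Union>x\<in>X. b x) = cfun.span (\<Union>x\<in>X. E x)"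
  proof
    show "cfun.span (\<Union>x\<in>X. b x) \<subseteq> cfun.span (\<Union>x\<in>X. E x)"
      using b(1) by (intro cfun.span_mono) blast
    have "E x \<subseteq> cfun.span (\<Union>x\<in>X. b x)" if "x \<in> X" for x
      using b(3) [of x] cfun.span_mono [of "b x" "\<Union>x\<in>X. b x"] that by blast
    then show "cfun.span (\<Union>x\<in>X. E x) \<subseteq> cfun.span (\<Union>x\<in>X. b x)"
      by (intro cfun.span_minimal cfun.subspace_span) blast
  qed
  moreover have "card (\<Union>x\<in>X. b x) = (\<Sum>x\<in>X. cfun.dim (E x))"
    using disj by (subst card_UN_disjoint) (auto simp: assms fin b(4))
  ultimately show thesis
    using assms fin by (intro that [of "\<Union>x\<in>X. b x"]) auto
qed

text \<open>The span and the functions on \<open>I\<close> are subspaces meeting only in 0, so their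
  dimensions add up to at most \<open>card V\<close>. This turns a trivial intersection into a bound
  on the number of eigenvalues in \<open>X\<close>, with multiplicity.\<close>

lemma sum_dim_E_le:
  assumes "finite X" "I \<subseteq> V"
    and I: "\<And>\<phi>. \<phi> \<in> cfun.span (\<Union>x\<in>X. E x) \<Longrightarrow> \<phi> \<in> functions_on I \<Longrightarrow> \<phi> = 0"
  shows "(\<Sum>x\<in>X. cfun.dim (E x)) + card I \<le> card V"
proof -
  interpret cfun_pair: vector_space_pair fun_scale fun_scale
    by unfold_locales
  obtain B where B: "cfun.independent B" "finite B"
    "cfun.span B = cfun.span (\<Union>x\<in>X. E x)" "card B = (\<Sum>x\<in>X. cfun.dim (E x))"
    using span_E_basis [OF assms(1)] .
  \<comment> \<open>restriction to \<open>V - I\<close> is injective on the span\<close>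
  define R where "R \<phi> = (\<lambda>v. if v \<in> V - I then \<phi> v else 0)" for \<phi> :: "'a \<Rightarrow> complex"
  have lin: "Vector_Spaces.linear fun_scale fun_scale R"
    by (auto simp: Vector_Spaces.linear_iff R_def fun_eq_iff intro: cfun.vector_space_axioms)
  have "B \<subseteq> functions_on V"
    using B(3) cfun.span_superset [of B] E_functions_on
      cfun.span_minimal [OF _ subspace_functions_on, of "\<Union>x\<in>X. E x" V] by blast
  then have span: "cfun.span B \<subseteq> functions_on V"
    by (intro cfun.span_minimal subspace_functions_on)
  have "\<phi> = 0" if "\<phi> \<in> cfun.span B" "R \<phi> = 0" for \<phi>
  proof (rule I)
    have "\<phi> v = 0" if "v \<notin> I" for v
    proof (cases "v \<in> V")
      case True
      then show ?thesis
        using fun_cong [OF \<open>R \<phi> = 0\<close>, of v] \<open>v \<notin> I\<close> by (simp add: R_def)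
    next
      case False
      then show ?thesis
        using \<open>\<phi> \<in> cfun.span B\<close> span by (auto simp: functions_on_def)
    qed
    then show "\<phi> \<in> functions_on I"
      by (simp add: functions_on_def)
  qed (use that B in auto)
  then have inj: "inj_on R (cfun.span B)"
    using cfun_pair.linear_inj_on_iff_eq_0 [OF lin cfun.subspace_span] by blast
  then have "cfun.independent (R ` B)"
    using cfun_pair.linear_independent_injective_image B(1) lin by blast
  then have "card (R ` B) \<le> card (V - I)"
    using finite_V by (intro conjunct2 [OF independent_functions_on])
      (auto simp: R_def functions_on_def)
  moreover have "card (R ` B) = card B"
    using inj cfun.span_superset by (metis card_image inj_on_subset)
  ultimately show ?thesis
    using B(4) card_mono [OF finite_V assms(2)] finite_subset [OF assms(2) finite_V] assms(2)
    by (simp add: card_Diff_subset)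
qed

definition point_spectrum :: "real set" where
  "point_spectrum = {x. \<exists>\<phi>\<in>E x. \<phi> \<noteq> 0}"

lemma dim_E_pos:
  assumes "x \<in> point_spectrum"
  shows "cfun.dim (E x) > 0"
proof (rule ccontr)
  assume "\<not> cfun.dim (E x) > 0"
  moreover obtain B where "cfun.independent B" "finite B" "cfun.span B = cfun.span (E x)"
      "card B = cfun.dim (E x)"
    using span_E_basis [of "{x}"] by auto
  ultimately have "cfun.span (E x) = {0}"
    by simp
  then show False
    using assms cfun.span_superset [of "E x"] by (auto simp: point_spectrum_def)
qed

lemma finite_point_spectrum: "finite point_spectrum"
proof (rule ccontr)
  assume "infinite point_spectrum"
  then obtain X where X: "finite X" "card X = Suc (card V)" "X \<subseteq> point_spectrum"
    using infinite_arbitrarily_large by blast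
  have "card X = (\<Sum>x\<in>X. 1)" by simp
  also have "\<dots> \<le> (\<Sum>x\<in>X. cfun.dim (E x))"
    using dim_E_pos X(3) by (intro sum_mono) (auto simp: Suc_le_eq)
  \<comment> \<open>For \<open>I = {}\<close> the intersection condition is automatic:
    \<open>functions_on {}\<close> contains only 0.\<close>
  also have "\<dots> \<le> card V"
    using sum_dim_E_le [OF X(1), of "{}"] by (auto simp: functions_on_def fun_eq_iff)
  finally show False using X(2) by simp
qed

text \<open>By \<open>span_E\<close> an eigenbasis is a basis of the whole space. This gives the
  list of eigenvalues its full length, so that the \<open>k\<close>-th one exists for every
  \<open>k\<close> up to \<open>card V\<close>.\<close>

lemma sum_dim_E: "(\<Sum>x\<in>point_spectrum. cfun.dim (E x)) = card V"
proof -
  obtain B where B: "cfun.independent B"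
      "cfun.span B = cfun.span (\<Union>x\<in>point_spectrum. E x)"
      "card B = (\<Sum>x\<in>point_spectrum. cfun.dim (E x))"
    using span_E_basis [OF finite_point_spectrum] .
  have "E x \<subseteq> cfun.span (\<Union>x\<in>point_spectrum. E x)" for x
  proof (cases "x \<in> point_spectrum")
    case True
    then show ?thesis by (auto intro: cfun.span_base)
  next
    case False
    then have "E x \<subseteq> {0}" by (auto simp: point_spectrum_def)
    then show ?thesis using cfun.span_zero by blast
  qed
  then have "cfun.span (\<Union>x. E x) \<subseteq> cfun.span (\<Union>x\<in>point_spectrum. E x)"
    by (intro cfun.span_minimal cfun.subspace_span) blast
  then have "functions_on V \<subseteq> cfun.span B"
    using span_E B(2) by simp
  moreover have "B \<subseteq> functions_on V"
    using cfun.span_superset [of B] cfun.span_mono [of "\<Union>x\<in>point_spectrum. E x" "\<Union>x. E x"]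
      span_E B(2) by blast
  ultimately have "card B = cfun.dim (functions_on V)"
    using B(1) by (intro cfun.basis_card_eq_dim)
  then show ?thesis
    using B(3) dim_functions_on [OF finite_V] by simp
qed

section \<open>Rayleigh quotients on sums of eigenspaces\<close>

lemma inner_on_E_sum:
  assumes "finite Y" "\<And>x. g x \<in> E x"
  shows "inner_on V (\<Sum>x\<in>Y. fun_scale (h x) (g x)) (\<Sum>x\<in>Y. g x)
    = (\<Sum>x\<in>Y. h x * inner_on V (g x) (g x))"
proof -
  have "(\<Sum>y\<in>Y. inner_on V (fun_scale (h x) (g x)) (g y)) = h x * inner_on V (g x) (g x)"
    if "x \<in> Y" for x
  proof -
    have "(\<Sum>y\<in>Y. inner_on V (fun_scale (h x) (g x)) (g y))
        = (\<Sum>y\<in>{x}. inner_on V (fun_scale (h x) (g x)) (g y))"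
      using assms that E_orthogonal [OF assms(2) assms(2)]
      by (intro sum.mono_neutral_right) (auto simp: inner_on_simps)
    then show ?thesis by (simp add: inner_on_simps)
  qed
  then show ?thesis
    unfolding inner_on_sum_left unfolding inner_on_sum_right by simp
qed

text \<open>In terms of the orthogonal components the hypothesis reads: the sum of
  \<open>(c - x) * |g x|^2\<close> is at most 0. All summands are nonnegative, so only the component
  for \<open>c\<close> survives.\<close>

lemma Rayleigh_extremal:
  assumes span: "\<phi> \<in> cfun.span (\<Union>x\<in>X. E x)" and X: "\<And>x. x \<in> X \<Longrightarrow> x \<le> c"
    and ge: "Re (inner_on V (T \<phi>) \<phi>) \<ge> c * Re (inner_on V \<phi> \<phi>)"
  shows "T \<phi> = fun_scale (complex_of_real c) \<phi>"
    and "c \<notin> X \<Longrightarrow> \<phi> = 0"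
proof -
  obtain Y g where Y: "finite Y" "Y \<subseteq> X" and g: "\<And>x. g x \<in> E x" and \<phi>: "\<phi> = (\<Sum>x\<in>Y. g x)"
    using span_E_decomposition [OF span] by blast
  have T_\<phi>: "T \<phi> = (\<Sum>x\<in>Y. fun_scale (complex_of_real x) (g x))"
    unfolding \<phi> T_sum using g by (intro sum.cong) (auto simp: E_def)
  have "Re (inner_on V (T \<phi>) \<phi>) = (\<Sum>x\<in>Y. x * Re (inner_on V (g x) (g x)))"
    unfolding T_\<phi> unfolding \<phi> inner_on_E_sum [OF Y(1) g] by simp
  moreover have "Re (inner_on V \<phi> \<phi>) = (\<Sum>x\<in>Y. Re (inner_on V (g x) (g x)))"
    using inner_on_E_sum [OF Y(1) g, of "\<lambda>_. 1"] unfolding \<phi> by simp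
  ultimately have "(\<Sum>x\<in>Y. (c - x) * Re (inner_on V (g x) (g x))) \<le> 0"
    using ge by (simp add: sum_distrib_left left_diff_distrib sum_subtractf)
  moreover have nonneg: "(c - x) * Re (inner_on V (g x) (g x)) \<ge> 0" if "x \<in> Y" for x
    using X Y that Re_inner_on_self_nonneg by (intro mult_nonneg_nonneg) auto
  ultimately have "(\<Sum>x\<in>Y. (c - x) * Re (inner_on V (g x) (g x))) = 0"
    by (intro antisym sum_nonneg) auto
  then have "\<forall>x\<in>Y. (c - x) * Re (inner_on V (g x) (g x)) = 0"
    using nonneg by (subst (asm) sum_nonneg_eq_0_iff [OF Y(1)]) auto
  then have 0: "g x = 0" if "x \<in> Y" "x \<noteq> c" for x
    using that g E_functions_on inner_on_self_eq_0 [OF finite_V, of "g x"] by fastforce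
  have "T \<phi> = (\<Sum>x\<in>Y. fun_scale (complex_of_real c) (g x))"
    unfolding T_\<phi> using 0 by (intro sum.cong) (auto simp: fun_eq_iff)
  then show "T \<phi> = fun_scale (complex_of_real c) \<phi>"
    by (simp only: \<phi> cfun.scale_sum_right)
  assume "c \<notin> X"
  then have "(\<Sum>x\<in>Y. g x) = 0"
    using 0 Y(2) by (intro sum.neutral) auto
  then show "\<phi> = 0" by (simp only: \<phi>)
qed

end

section \<open>The magnetic Laplacian\<close>

lemma sorted_concat_replicate:
  "sorted xs \<Longrightarrow> sorted (concat (map (\<lambda>x. replicate (d x) x) xs))"
  by (induction xs) (auto simp: sorted_append)

lemma length_filter_concat_replicate:
  "distinct xs \<Longrightarrow> length (filter P (concat (map (\<lambda>x. replicate (d x) x) xs)))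
     = (\<Sum>x\<in>{x\<in>set xs. P x}. d x)"
proof (induction xs)
  case (Cons y ys)
  have "{x \<in> set (y # ys). P x}
      = (if P y then insert y {x\<in>set ys. P x} else {x\<in>set ys. P x})"
    by auto
  with Cons show ?case by auto
qed simp

text \<open>\<open>P\<close> is closed downwards: if it held at position \<open>k\<close>, counted
  from 0, it would hold for the first \<open>k + 1\<close> entries.\<close>

lemma sorted_nth_not:
  assumes "sorted xs" "length (filter P xs) \<le> k" "k < length xs"
    and P: "\<And>x y. x \<le> y \<Longrightarrow> P y \<Longrightarrow> P x"
  shows "\<not> P (xs ! k)"
proof
  assume "P (xs ! k)"
  have "P x" if x: "x \<in> set (take (Suc k) xs)" for x
  proof -
    obtain i where "i \<le> k" "x = xs ! i"
      using x by (auto simp: in_set_conv_nth less_Suc_eq_le)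
    then show ?thesis
      using P \<open>P (xs ! k)\<close> sorted_nth_mono [OF assms(1) \<open>i \<le> k\<close> assms(3)] by blast
  qed
  then have "length (filter P (take (Suc k) xs)) = Suc k"
    using assms(3) by (simp add: filter_True)
  moreover have "length (filter P (take (Suc k) xs)) \<le> length (filter P xs)"
    by (metis append_take_drop_id filter_append le_add1 length_append)
  ultimately show False using assms(2) by simp
qed

section \<open>Arc reversal and the quadratic form\<close>

locale magnetic_graph = graph G for G :: "('a, 'b) pre_digraph" +
  fixes \<alpha> :: "'b \<Rightarrow> real"
  assumes potential: "magnetic_potential G \<alpha>"
begin

text \<open>Arcs are abstract, so the reverse is chosen. It exists by symmetry and is unique because
  there are no parallel arcs.\<close>

definition arc_rev :: "'b \<Rightarrow> 'b" where
  "arc_rev e = (SOME e'. e' \<in> arcs G \<and> tail G e' = head G e \<and> head G e' = tail G e)"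

definition phase :: "'b \<Rightarrow> complex" where
  "phase e = exp (\<i> * complex_of_real (\<alpha> e))"

text \<open>The twisted discrete derivative, signed so that the Laplacian is its sum over outgoing
  arcs.\<close>

definition coboundary :: "('a \<Rightarrow> complex) \<Rightarrow> 'b \<Rightarrow> complex" where
  "coboundary \<phi> e = \<phi> (tail G e) - phase e * \<phi> (head G e)"

lemma arc_rev:
  assumes "e \<in> arcs G"
  shows "arc_rev e \<in> arcs G" "tail G (arc_rev e) = head G e" "head G (arc_rev e) = tail G e"
proof -
  have "\<exists>e'. e' \<in> arcs G \<and> tail G e' = head G e \<and> head G e' = tail G e"
    using sym_arcs assms unfolding symmetric_conv by metis
  from someI_ex [OF this] show "arc_rev e \<in> arcs G" "tail G (arc_rev e) = head G e"
      "head G (arc_rev e) = tail G e"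
    unfolding arc_rev_def by blast+
qed

lemma arc_eqI:
  assumes "e \<in> arcs G" "e' \<in> arcs G" "tail G e = tail G e'" "head G e = head G e'"
  shows "e = e'"
  using no_multi_arcs assms by (simp add: arc_to_ends_def)

lemma arc_rev_arc_rev: "e \<in> arcs G \<Longrightarrow> arc_rev (arc_rev e) = e"
  by (intro arc_eqI) (simp_all add: arc_rev)

lemma norm_phase [simp]: "cmod (phase e) = 1"
  by (simp add: phase_def)

lemma phase_neq_0 [simp]: "phase e \<noteq> 0"
  by (simp add: phase_def)

lemma phase_mult_cnj [simp]: "phase e * cnj (phase e) = 1"
  by (simp add: complex_norm_square [symmetric])

text \<open>Antisymmetry holds only modulo \<open>2 * pi\<close>; the exponential absorbs the
  multiple.\<close>

lemma phase_arc_rev: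
  assumes "e \<in> arcs G"
  shows "phase (arc_rev e) = cnj (phase e)"
proof -
  have "[\<alpha> (arc_rev e) = - \<alpha> e] (rmod (2 * pi))"
    using potential assms arc_rev [OF assms] by (simp add: magnetic_potential_def)
  then obtain n where "\<alpha> (arc_rev e) = - \<alpha> e + of_int n * (2 * pi)"
    using rcong_sym unfolding rcong_altdef by blast
  then have "phase (arc_rev e) = cis (- \<alpha> e) * cis (of_int n * (2 * pi))"
    unfolding phase_def cis_conv_exp [symmetric] by (simp add: cis_mult)
  also have "cis (of_int n * (2 * pi)) = 1"
    using cis_multiple_2pi [of "of_int n"] by (simp add: mult.commute mult.left_commute)
  finally show ?thesis
    by (simp add: phase_def cis_conv_exp [symmetric] cis_cnj)
qed

lemma coboundary_arc_rev:
  assumes "e \<in> arcs G"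
  shows "coboundary \<phi> (arc_rev e) = - cnj (phase e) * coboundary \<phi> e"
proof -
  have "cnj (phase e) * (phase e * \<phi> (head G e)) = \<phi> (head G e)"
    using phase_mult_cnj [of e] by (metis mult.assoc mult.commute mult.left_neutral)
  then show ?thesis
    using assms by (simp add: coboundary_def arc_rev phase_arc_rev algebra_simps)
qed

lemma magnetic_laplacian_conv_coboundary:
  "magnetic_laplacian G \<alpha> \<phi> v = (\<Sum>e\<in>out_arcs G v. coboundary \<phi> e)"
  by (simp add: magnetic_laplacian_def coboundary_def phase_def out_degree_def sum_subtractf)

text \<open>Summation by parts. Grouping arcs by tail gives one expression; reversing all arcs turns
  it into one with heads. Their sum is the energy over all arcs, hence the division by 2.\<close>

lemma inner_on_magnetic_laplacian:
  "inner_on (verts G) (magnetic_laplacian G \<alpha> \<phi>) \<psi>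
     = (\<Sum>e\<in>arcs G. coboundary \<phi> e * cnj (coboundary \<psi> e)) / 2"
proof -
  have tails: "inner_on (verts G) (magnetic_laplacian G \<alpha> \<phi>) \<psi>
      = (\<Sum>e\<in>arcs G. coboundary \<phi> e * cnj (\<psi> (tail G e)))"
  proof -
    have "inner_on (verts G) (magnetic_laplacian G \<alpha> \<phi>) \<psi>
        = (\<Sum>v\<in>verts G. \<Sum>e | e \<in> arcs G \<and> tail G e = v. coboundary \<phi> e * cnj (\<psi> (tail G e)))"
      by (simp add: inner_on_def magnetic_laplacian_conv_coboundary sum_distrib_right out_arcs_def)
    also have "\<dots> = (\<Sum>e\<in>arcs G. coboundary \<phi> e * cnj (\<psi> (tail G e)))"
      by (rule sum.group) auto
    finally show ?thesis .
  qed
  also have "\<dots> = (\<Sum>e\<in>arcs G. coboundary \<phi> (arc_rev e) * cnj (\<psi> (tail G (arc_rev e))))"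
    by (rule sum.reindex_bij_witness [of _ arc_rev arc_rev]) (simp_all add: arc_rev arc_rev_arc_rev)
  also have "\<dots> = (\<Sum>e\<in>arcs G. coboundary \<phi> e * cnj (- phase e * \<psi> (head G e)))"
    by (intro sum.cong) (simp_all add: arc_rev coboundary_arc_rev)
  finally have "2 * inner_on (verts G) (magnetic_laplacian G \<alpha> \<phi>) \<psi>
      = (\<Sum>e\<in>arcs G. coboundary \<phi> e * cnj (\<psi> (tail G e)))
        + (\<Sum>e\<in>arcs G. coboundary \<phi> e * cnj (- phase e * \<psi> (head G e)))"
    using tails by simp
  also have "\<dots> = (\<Sum>e\<in>arcs G. coboundary \<phi> e * cnj (coboundary \<psi> e))"
    unfolding sum.distrib [symmetric]
    by (intro sum.cong) (simp_all add: coboundary_def [of \<psi>] algebra_simps)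
  finally show ?thesis by (simp add: mult.commute)
qed

lemma Re_inner_on_magnetic_laplacian:
  "2 * Re (inner_on (verts G) (magnetic_laplacian G \<alpha> \<phi>) \<phi>) = (\<Sum>e\<in>arcs G. (cmod (coboundary \<phi> e))\<^sup>2)"
  by (simp add: inner_on_magnetic_laplacian complex_norm_square [symmetric])

sublocale laplacian: self_adjoint_operator "verts G" "magnetic_laplacian G \<alpha>"
proof
  fix \<phi> \<psi> c
  show "magnetic_laplacian G \<alpha> (\<phi> + \<psi>) = magnetic_laplacian G \<alpha> \<phi> + magnetic_laplacian G \<alpha> \<psi>"
    by (auto simp: fun_eq_iff magnetic_laplacian_def algebra_simps sum.distrib)
  show "magnetic_laplacian G \<alpha> (fun_scale c \<phi>) = fun_scale c (magnetic_laplacian G \<alpha> \<phi>)"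
    by (auto simp: fun_eq_iff magnetic_laplacian_def algebra_simps sum_distrib_left)
  have "out_arcs G v = {}" if "v \<notin> verts G" for v
    using that by (auto simp: out_arcs_def)
  then show "magnetic_laplacian G \<alpha> \<phi> \<in> functions_on (verts G)"
    by (simp add: functions_on_def magnetic_laplacian_conv_coboundary)
  \<comment> \<open>Symmetry follows because the energy formula is Hermitian in its two
    arguments.\<close>
  have "inner_on (verts G) \<phi> (magnetic_laplacian G \<alpha> \<psi>)
      = cnj (inner_on (verts G) (magnetic_laplacian G \<alpha> \<psi>) \<phi>)"
    by (simp add: inner_on_def mult.commute)
  then show "inner_on (verts G) (magnetic_laplacian G \<alpha> \<phi>) \<psi>
      = inner_on (verts G) \<phi> (magnetic_laplacian G \<alpha> \<psi>)"
    by (simp add: inner_on_magnetic_laplacian mult.commute)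
qed simp

section \<open>The spectrum as a sorted list with multiplicities\<close>

lemma E_eq_eigenspace: "laplacian.E = eigenspace G \<alpha>"
  by (simp add: fun_eq_iff laplacian.E_def eigenspace_def)

lemma point_spectrum_eq_eigenvalues: "laplacian.point_spectrum = eigenvalues G \<alpha>"
  by (simp add: laplacian.point_spectrum_def eigenvalues_def E_eq_eigenspace)

lemma finite_eigenvalues: "finite (eigenvalues G \<alpha>)"
  using laplacian.finite_point_spectrum by (simp add: point_spectrum_eq_eigenvalues)

lemma length_filter_spectrum_list:
  "length (filter P (spectrum_list G \<alpha>))
     = (\<Sum>x\<in>{x\<in>eigenvalues G \<alpha>. P x}. cfun.dim (eigenspace G \<alpha> x))"
  unfolding spectrum_list_def
  by (subst length_filter_concat_replicate) (simp_all add: finite_eigenvalues)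

lemma length_spectrum_list: "length (spectrum_list G \<alpha>) = card (verts G)"
  using length_filter_spectrum_list [of "\<lambda>_. True"] laplacian.sum_dim_E
  by (simp add: point_spectrum_eq_eigenvalues E_eq_eigenspace)

text \<open>At most \<open>card (verts G) - card I < k\<close> eigenvalues satisfy \<open>P\<close>,
  and since \<open>P\<close> is closed downwards they come first in the list.\<close>

lemma eigval_not:
  assumes I: "I \<subseteq> verts G"
      "\<And>\<phi>. \<phi> \<in> cfun.span (\<Union>x\<in>{x\<in>eigenvalues G \<alpha>. P x}. laplacian.E x)
        \<Longrightarrow> \<phi> \<in> functions_on I \<Longrightarrow> \<phi> = 0"
    and P: "\<And>x y. x \<le> y \<Longrightarrow> P y \<Longrightarrow> P x"
    and k: "card (verts G) < k + card I" "0 < k" "k \<le> card (verts G)"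
  shows "\<not> P (eigval k G \<alpha>)"
  unfolding eigval_def
proof (rule sorted_nth_not)
  show "sorted (spectrum_list G \<alpha>)"
    unfolding spectrum_list_def by (intro sorted_concat_replicate) simp
  have "length (filter P (spectrum_list G \<alpha>)) + card I \<le> card (verts G)"
    using laplacian.sum_dim_E_le [OF _ I] finite_eigenvalues
    by (simp add: length_filter_spectrum_list E_eq_eigenspace)
  \<comment> \<open>\<open>eigval\<close> counts from 1, list positions from 0.\<close>
  then show "length (filter P (spectrum_list G \<alpha>)) \<le> k - 1"
    using k by simp
  show "k - 1 < length (spectrum_list G \<alpha>)"
    using k by (simp add: length_spectrum_list)
qed (fact P)

end

section \<open>Hamiltonian graphs\<close>

text \<open>The cycle is read periodically along all natural numbers, so its closing arc needs no
  special treatment later.\<close>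

lemma (in wf_digraph) hamiltonian_enumeration:
  assumes "finite (verts G)" "hamiltonian G"
  obtains v :: "nat \<Rightarrow> 'a" and a :: "nat \<Rightarrow> 'b"
  where "bij_betw v {..<card (verts G)} (verts G)" "\<And>i. v (i + card (verts G)) = v i"
    "\<And>i. a i \<in> arcs G" "\<And>i. tail G (a i) = v i" "\<And>i. head G (a i) = v (Suc i)"
proof -
  let ?n = "card (verts G)"
  obtain p u where walk: "awalk u p u" and dist: "distinct (tl (awalk_verts u p))" and "p \<noteq> []"
    and tails: "tail G ` set p = verts G"
    using assms(2) by (auto simp: hamiltonian_def cycle_def)
  have arcs: "set p \<subseteq> arcs G" and cas: "cas u p u"
    using walk by (auto elim: awalkE)
  \<comment> \<open>The vertices are the tails followed by the last head, or the first tail followed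
    by the heads. Comparing both readings shows that each arc starts where the previous one
    ends.\<close>
  have verts_eq: "awalk_verts u p = map (tail G) p @ [head G (last p)]"
    using \<open>p \<noteq> []\<close> by (simp add: awalk_verts_conv)
  have verts_eq': "awalk_verts u p = tail G (hd p) # map (head G) p"
    using \<open>p \<noteq> []\<close> cas by (simp add: awalk_verts_conv')
  \<comment> \<open>Distinct heads bound the length of \<open>p\<close> from above, tails covering
    all vertices bound it from below.\<close>
  have "distinct (map (head G) p)"
    using dist verts_eq' by simp
  then have "length p = card (head G ` set p)"
    using distinct_card by fastforce
  also have "\<dots> \<le> ?n"
    using arcs by (intro card_mono assms(1)) auto
  finally have "length p \<le> ?n" .
  moreover have "?n \<le> length p"
    using card_image_le [of "set p" "tail G"] card_length [of p] by (simp add: tails)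
  ultimately have len: "length p = ?n" by simp
  have "0 < ?n"
    using \<open>p \<noteq> []\<close> by (simp flip: len)
  have "card (set (map (tail G) p)) = length (map (tail G) p)"
    by (simp add: tails len)
  then have "distinct (map (tail G) p)"
    by (rule card_distinct)
  then have "bij_betw (\<lambda>i. map (tail G) p ! i) {..<?n} (verts G)"
    by (rule bij_betw_nth) (simp_all add: len tails)
  moreover have "map (tail G) p ! i = tail G (p ! (i mod ?n))" if "i \<in> {..<?n}" for i
    using that by (simp add: len)
  ultimately have bij: "bij_betw (\<lambda>i. tail G (p ! (i mod ?n))) {..<?n} (verts G)"
    using bij_betw_cong [of "{..<?n}" "\<lambda>i. map (tail G) p ! i" "\<lambda>i. tail G (p ! (i mod ?n))" "verts G"]
    by blast
  have step: "head G (p ! (i mod ?n)) = tail G (p ! (Suc i mod ?n))" for i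
  proof (cases "Suc (i mod ?n) = ?n")
    \<comment> \<open>Wrap-around: the last arc ends at \<open>u\<close>, where the first one
      starts.\<close>
    case True
    have "u = tail G (p ! 0)"
      using \<open>p \<noteq> []\<close> walk by (cases p) (auto simp: awalk_Cons_iff)
    moreover have "u = head G (last p)"
      using walk \<open>p \<noteq> []\<close> verts_eq awlast_if_cas [OF cas] by simp
    moreover have "last p = p ! (i mod ?n)"
      using True \<open>p \<noteq> []\<close> len by (metis diff_Suc_1 last_conv_nth)
    moreover have "Suc i mod ?n = 0"
      using True by (simp add: mod_Suc)
    ultimately show ?thesis by simp
  next
    case False
    have lt: "i mod ?n < length p"
      using len \<open>0 < ?n\<close> by simp
    then have "Suc (i mod ?n) < length p"
      using False len by simp
    have "head G (p ! (i mod ?n)) = awalk_verts u p ! Suc (i mod ?n)"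
      using lt by (simp add: verts_eq')
    also have "\<dots> = tail G (p ! Suc (i mod ?n))"
      using \<open>Suc (i mod ?n) < length p\<close> by (simp add: verts_eq nth_append)
    finally show ?thesis
      using False by (simp add: mod_Suc)
  qed
  show thesis
  proof (rule that [of "\<lambda>i. tail G (p ! (i mod ?n))" "\<lambda>i. p ! (i mod ?n)"])
    show "p ! (i mod ?n) \<in> arcs G" for i
      using arcs len \<open>0 < ?n\<close> by (metis mod_less_divisor nth_mem subsetD)
  qed (use bij step in simp_all)
qed

section \<open>Indices and arcs of the Hamiltonian cycle\<close>

locale hamiltonian_magnetic_graph = magnetic_graph +
  fixes v :: "nat \<Rightarrow> 'a" and a :: "nat \<Rightarrow> 'b"
  assumes order_gt_2: "card (verts G) > 2"
    and bij: "bij_betw v {..<card (verts G)} (verts G)"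
    and period: "v (i + card (verts G)) = v i"
    and arc: "a i \<in> arcs G" "tail G (a i) = v i" "head G (a i) = v (Suc i)"
begin

lemma v_mod: "v (i mod card (verts G)) = v i"
proof -
  have "v (i + k * card (verts G)) = v i" for i k
  proof (induction k)
    case (Suc k)
    then show ?case
      using period [of "i + k * card (verts G)"] by (simp add: algebra_simps)
  qed simp
  from this [of "i mod card (verts G)" "i div card (verts G)"] show ?thesis
    by simp
qed

lemma v_eq_iff: "v i = v j \<longleftrightarrow> i mod card (verts G) = j mod card (verts G)"
proof -
  have "i mod card (verts G) \<in> {..<card (verts G)}" "j mod card (verts G) \<in> {..<card (verts G)}"
    using order_gt_2 by auto
  then show ?thesis
    using bij_betw_imp_inj_on [OF bij] v_mod unfolding inj_on_def by metis
qed

lemma v_Suc_Suc_neq: "v (Suc (Suc i)) \<noteq> v i"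
proof
  assume "v (Suc (Suc i)) = v i"
  then have "card (verts G) dvd 2"
    using mod_eq_dvd_iff_nat [of i "Suc (Suc i)" "card (verts G)"] by (simp add: v_eq_iff)
  then show False
    using order_gt_2 by (auto dest: dvd_imp_le)
qed

lemma v_Suc_eq: "v i = v j \<Longrightarrow> v (Suc i) = v (Suc j)"
  unfolding v_eq_iff by (simp add: mod_Suc)

lemma v_Suc_inject: "v (Suc i) = v (Suc j) \<Longrightarrow> v i = v j"
proof -
  assume "v (Suc i) = v (Suc j)"
  \<comment> \<open>Adding \<open>card (verts G) - 1\<close> inverts the successor modulo
    \<open>card (verts G)\<close>.\<close>
  then have "(Suc i + (card (verts G) - 1)) mod card (verts G)
      = (Suc j + (card (verts G) - 1)) mod card (verts G)"
    unfolding v_eq_iff by (rule mod_add_cong) simp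
  then show "v i = v j"
    using order_gt_2 by (simp add: v_eq_iff)
qed

lemma a_eq_iff: "a i = a j \<longleftrightarrow> v i = v j"
proof
  show "a i = a j \<Longrightarrow> v i = v j"
    by (metis arc(2))
  show "v i = v j \<Longrightarrow> a i = a j"
    by (intro arc_eqI) (simp_all add: arc v_Suc_eq [of i j])
qed

text \<open>Otherwise the cycle would return to \<open>v j\<close> after two steps.\<close>

lemma a_neq_arc_rev: "a i \<noteq> arc_rev (a j)"
proof
  assume "a i = arc_rev (a j)"
  then have "v i = v (Suc j)" "v (Suc i) = v j"
    using arc arc_rev by metis+
  then show False
    using v_Suc_eq v_Suc_Suc_neq by metis
qed

definition cycle_arcs :: "'b set" where
  "cycle_arcs = a ` {..<card (verts G)} \<union> (arc_rev \<circ> a) ` {..<card (verts G)}"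

lemma cycle_arcs_subset: "cycle_arcs \<subseteq> arcs G"
  using arc arc_rev by (auto simp: cycle_arcs_def)

lemma range_cycle_arcs: "a i \<in> cycle_arcs" "arc_rev (a i) \<in> cycle_arcs"
proof -
  have "a i = a (i mod card (verts G))"
    by (simp add: a_eq_iff v_mod)
  moreover have "i mod card (verts G) < card (verts G)"
    using order_gt_2 by simp
  ultimately show "a i \<in> cycle_arcs" "arc_rev (a i) \<in> cycle_arcs"
    unfolding cycle_arcs_def by (metis UnI1 imageI lessThan_iff, metis UnI2 comp_apply imageI lessThan_iff)
qed

text \<open>The cycle leaves a vertex forwards along its own arc and backwards along the reverse of
  the arriving one. The index \<open>Suc i\<close> makes the predecessor available without
  subtraction.\<close>

lemma cycle_arcs_out:
  "out_arcs G (v (Suc i)) \<inter> cycle_arcs = {a (Suc i), arc_rev (a i)}"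
proof (intro equalityI subsetI)
  fix e assume "e \<in> out_arcs G (v (Suc i)) \<inter> cycle_arcs"
  then have e: "tail G e = v (Suc i)" "e \<in> cycle_arcs" by auto
  then consider j where "e = a j" | j where "e = arc_rev (a j)"
    by (auto simp: cycle_arcs_def)
  then show "e \<in> {a (Suc i), arc_rev (a i)}"
  proof cases
    case 1
    then show ?thesis using e(1) arc(2) a_eq_iff by auto
  next
    case 2
    then have "v (Suc j) = v (Suc i)"
      using e(1) arc arc_rev by metis
    then have "a j = a i"
      unfolding a_eq_iff by (rule v_Suc_inject)
    then show ?thesis using 2 by simp
  qed
qed (auto simp: range_cycle_arcs arc arc_rev)

section \<open>Energy along the cycle and on the chords\<close>

lemma sum_v:
  fixes f :: "'a \<Rightarrow> real"
  shows "(\<Sum>i<card (verts G). f (v i)) = sum f (verts G)"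
    and "(\<Sum>i<card (verts G). f (v (Suc i))) = sum f (verts G)"
proof -
  show 1: "(\<Sum>i<card (verts G). f (v i)) = sum f (verts G)"
    by (rule sum.reindex_bij_betw [OF bij])
  \<comment> \<open>The added term completes the sum over one index more than a period; periodicity
    identifies its two extreme terms.\<close>
  have "(\<Sum>i<card (verts G). f (v (Suc i))) + f (v 0) = (\<Sum>i<Suc (card (verts G)). f (v i))"
    by (subst sum.lessThan_Suc_shift) simp
  also have "\<dots> = sum f (verts G) + f (v 0)"
    using 1 period [of 0] by simp
  finally show "(\<Sum>i<card (verts G). f (v (Suc i))) = sum f (verts G)" by simp
qed

text \<open>One end of each cycle edge carries 0, so there is no cross term and the phase drops out.
  Each vertex lies on two cycle edges with two arcs each, whence the factor 4.\<close>

lemma cycle_energy: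
  assumes "\<And>i. i < card (verts G) \<Longrightarrow> \<phi> (v i) = 0 \<or> \<phi> (v (Suc i)) = 0"
  shows "(\<Sum>e\<in>cycle_arcs. (cmod (coboundary \<phi> e))\<^sup>2) = 4 * Re (inner_on (verts G) \<phi> \<phi>)"
proof -
  let ?n = "card (verts G)" and ?f = "\<lambda>w. (cmod (\<phi> w))\<^sup>2"
  have "inj_on v {..<?n}"
    using bij by (rule bij_betw_imp_inj_on)
  then have inj: "inj_on a {..<?n}" "inj_on (arc_rev \<circ> a) {..<?n}"
    unfolding inj_on_def comp_def using a_eq_iff arc(1) arc_rev_arc_rev by metis+
  have E: "(cmod (coboundary \<phi> (a i)))\<^sup>2 = ?f (v i) + ?f (v (Suc i))" if "i < ?n" for i
    using assms [OF that] by (auto simp: coboundary_def arc norm_mult)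
  have E': "(cmod (coboundary \<phi> (arc_rev (a i))))\<^sup>2 = (cmod (coboundary \<phi> (a i)))\<^sup>2" for i
    by (simp add: coboundary_arc_rev arc norm_mult)
  have "(\<Sum>e\<in>cycle_arcs. (cmod (coboundary \<phi> e))\<^sup>2)
      = (\<Sum>e\<in>a ` {..<?n}. (cmod (coboundary \<phi> e))\<^sup>2)
        + (\<Sum>e\<in>(arc_rev \<circ> a) ` {..<?n}. (cmod (coboundary \<phi> e))\<^sup>2)"
    unfolding cycle_arcs_def using a_neq_arc_rev by (intro sum.union_disjoint) auto
  also have "\<dots> = 2 * (\<Sum>i<?n. ?f (v i) + ?f (v (Suc i)))"
    unfolding sum.reindex [OF inj(1)] sum.reindex [OF inj(2)] by (simp add: E' E)
  also have "\<dots> = 4 * (\<Sum>w\<in>verts G. ?f w)"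
    using sum_v [of ?f] by (simp add: sum.distrib)
  finally show ?thesis
    by (simp add: inner_on_self)
qed

lemma sum_arcs_split:
  fixes f :: "'b \<Rightarrow> real"
  shows "sum f (arcs G) = sum f (arcs G - cycle_arcs) + sum f cycle_arcs"
  by (rule sum.subset_diff [OF cycle_arcs_subset]) simp

text \<open>Chords contribute nonnegative energy, and the total energy is twice the quadratic
  form.\<close>

lemma Rayleigh_ge_2:
  assumes "\<And>i. i < card (verts G) \<Longrightarrow> \<phi> (v i) = 0 \<or> \<phi> (v (Suc i)) = 0"
  shows "Re (inner_on (verts G) (magnetic_laplacian G \<alpha> \<phi>) \<phi>) \<ge> 2 * Re (inner_on (verts G) \<phi> \<phi>)"
proof -
  have "(\<Sum>e\<in>arcs G - cycle_arcs. (cmod (coboundary \<phi> e))\<^sup>2) \<ge> 0"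
    by (intro sum_nonneg) simp
  then show ?thesis
    using Re_inner_on_magnetic_laplacian [of \<phi>] cycle_energy [OF assms]
      sum_arcs_split [of "\<lambda>e. (cmod (coboundary \<phi> e))\<^sup>2"] by linarith
qed

text \<open>Equality in \<open>Rayleigh_ge_2\<close> forces the coboundary to vanish on chords. The
  equation at \<open>v (Suc i)\<close> then involves only the two cycle neighbours, one of which
  carries 0.\<close>

lemma eigenvector_2_step:
  assumes indep: "\<And>i. i < card (verts G) \<Longrightarrow> \<phi> (v i) = 0 \<or> \<phi> (v (Suc i)) = 0"
    and eig: "magnetic_laplacian G \<alpha> \<phi> = fun_scale 2 \<phi>"
    and zero: "\<phi> (v i) = 0" "\<phi> (v (Suc i)) = 0"
  shows "\<phi> (v (Suc (Suc i))) = 0"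
proof -
  \<comment> \<open>With eigenvalue 2 the total energy is four times the squared norm, which the
    cycle already uses up.\<close>
  have "(\<Sum>e\<in>arcs G - cycle_arcs. (cmod (coboundary \<phi> e))\<^sup>2) = 0"
    using Re_inner_on_magnetic_laplacian [of \<phi>] cycle_energy [OF indep]
      sum_arcs_split [of "\<lambda>e. (cmod (coboundary \<phi> e))\<^sup>2"] by (simp add: eig inner_on_simps)
  then have chord: "\<forall>e\<in>arcs G - cycle_arcs. coboundary \<phi> e = 0"
    by (subst (asm) sum_nonneg_eq_0_iff) auto
  have "0 = (\<Sum>e\<in>out_arcs G (v (Suc i)). coboundary \<phi> e)"
    using fun_cong [OF eig, of "v (Suc i)"] zero(2)
    by (simp add: magnetic_laplacian_conv_coboundary)
  also have "\<dots> = (\<Sum>e\<in>out_arcs G (v (Suc i)) \<inter> cycle_arcs. coboundary \<phi> e)"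
    using chord by (intro sum.mono_neutral_right) auto
  also have "\<dots> = coboundary \<phi> (a (Suc i)) + coboundary \<phi> (arc_rev (a i))"
    by (simp add: cycle_arcs_out a_neq_arc_rev)
  also have "\<dots> = - phase (a (Suc i)) * \<phi> (v (Suc (Suc i)))"
    by (simp add: coboundary_def arc arc_rev zero)
  finally show ?thesis by simp
qed

section \<open>The eigenvalue bounds\<close>

lemma image_v_in_iff:
  assumes "J \<subseteq> {..<card (verts G)}" "i < card (verts G)"
  shows "v i \<in> v ` J \<longleftrightarrow> i \<in> J"
  using inj_on_image_mem_iff [OF bij_betw_imp_inj_on [OF bij]] assms by auto

lemma card_image_v:
  assumes "J \<subseteq> {..<card (verts G)}"
  shows "card (v ` J) = card J"
  using inj_on_subset [OF bij_betw_imp_inj_on [OF bij] assms] by (rule card_image)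

lemma image_v_subset:
  assumes "J \<subseteq> {..<card (verts G)}"
  shows "v ` J \<subseteq> verts G"
  using bij_betw_imp_surj_on [OF bij] assms by blast

text \<open>The even indices give half of the vertices. A function supported there has Rayleigh
  quotient at least 2, which no nonzero sum of eigenvectors with eigenvalues below 2
  attains.\<close>

lemma eigval_ge_2:
  assumes "even (card (verts G))"
  shows "2 \<le> eigval (card (verts G) div 2 + 1) G \<alpha>"
proof -
  let ?n = "card (verts G)"
  define J where "J = {i. i < ?n \<and> even i}"
  have J: "J \<subseteq> {..<?n}" by (auto simp: J_def)
  have "J = (*) 2 ` {..<?n div 2}"
    using assms by (auto simp: J_def elim!: evenE)
  then have card_J: "card J = ?n div 2"
    by (simp add: card_image inj_on_def)
  have "\<not> eigval (?n div 2 + 1) G \<alpha> < 2"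
  proof (rule eigval_not [OF image_v_subset [OF J]])
    fix \<phi> assume span: "\<phi> \<in> cfun.span (\<Union>x\<in>{x \<in> eigenvalues G \<alpha>. x < 2}. laplacian.E x)"
      and supp: "\<phi> \<in> functions_on (v ` J)"
    have zero: "\<phi> (v i) = 0" if "i < ?n" "odd i" for i
      using supp that image_v_in_iff [OF J] by (auto simp: functions_on_def J_def)
    have indep: "\<phi> (v i) = 0 \<or> \<phi> (v (Suc i)) = 0" if "i < ?n" for i
    proof (cases "odd i")
      case False
      \<comment> \<open>Parity excludes \<open>i = ?n - 1\<close>, so the closing edge causes no
        conflict.\<close>
      then have "Suc i < ?n" using that assms by (metis Suc_lessI even_Suc)
      then show ?thesis using zero False by simp
    qed (use zero that in simp)
    show "\<phi> = 0"
      using laplacian.Rayleigh_extremal(2) [OF span _ Rayleigh_ge_2 [OF indep]] by auto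
  qed (use order_gt_2 card_J card_image_v [OF J] assms in auto)
  then show ?thesis by simp
qed

text \<open>Dropping index 0 from the even ones leaves \<open>(card (verts G) - 1) div 2\<close>
  indices for either parity. It makes \<open>v 0\<close> and \<open>v 1\<close> consecutive zeros
  and gives the closing edge a zero end even for odd order.\<close>

lemma eigval_gt_2:
  assumes "card (verts G) - (card (verts G) - 1) div 2 < k" "k \<le> card (verts G)"
  shows "2 < eigval k G \<alpha>"
proof -
  let ?n = "card (verts G)"
  define J where "J = {i. i < ?n \<and> even i \<and> i \<noteq> 0}"
  have J: "J \<subseteq> {..<?n}" by (auto simp: J_def)
  have "J = (\<lambda>i. 2 * Suc i) ` {..<(?n - 1) div 2}"
  proof (intro equalityI subsetI)
    fix i assume "i \<in> J"
    then obtain j where "i = 2 * j" "j \<noteq> 0" "2 * j < ?n"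
      by (auto simp: J_def elim!: evenE)
    then show "i \<in> (\<lambda>i. 2 * Suc i) ` {..<(?n - 1) div 2}"
      by (intro image_eqI [of _ _ "j - 1"]) auto
  qed (auto simp: J_def)
  then have card_J: "card J = (?n - 1) div 2"
    by (simp add: card_image inj_on_def)
  have "\<not> eigval k G \<alpha> \<le> 2"
  proof (rule eigval_not [OF image_v_subset [OF J]])
    fix \<phi> assume span: "\<phi> \<in> cfun.span (\<Union>x\<in>{x \<in> eigenvalues G \<alpha>. x \<le> 2}. laplacian.E x)"
      and supp: "\<phi> \<in> functions_on (v ` J)"
    have zero: "\<phi> (v i) = 0" if "i < ?n" "odd i \<or> i = 0" for i
      using supp that image_v_in_iff [OF J] by (auto simp: functions_on_def J_def)
    have zero_n: "\<phi> (v ?n) = 0"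
      using zero [of 0] period [of 0] order_gt_2 by simp
    have indep: "\<phi> (v i) = 0 \<or> \<phi> (v (Suc i)) = 0" if "i < ?n" for i
      using zero [of i] zero [of "Suc i"] zero_n that by (cases "Suc i = ?n") auto
    have "magnetic_laplacian G \<alpha> \<phi> = fun_scale 2 \<phi>"
      using laplacian.Rayleigh_extremal(1) [OF span _ Rayleigh_ge_2 [OF indep]] by simp
    note step = eigenvector_2_step [OF indep this]
    \<comment> \<open>From the zeros at \<open>v 0\<close> and \<open>v 1\<close>, vanishing
      propagates around the cycle.\<close>
    have "\<phi> (v i) = 0 \<and> \<phi> (v (Suc i)) = 0" for i
      by (induction i) (use zero [of 0] zero [of 1] order_gt_2 step in auto)
    then show "\<phi> = 0"
      using supp by (simp add: functions_on_def fun_eq_iff) (metis imageE)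
  qed (use assms card_J card_image_v [OF J] in auto)
  then show ?thesis by simp
qed

end

theorem corollary4p4:
  fixes G :: "('a, 'b) pre_digraph" and \<alpha> :: "'b \<Rightarrow> real" and n :: nat
  assumes "graph G"
    and "n = card (verts G)" and "n > 3"
    and "hamiltonian G"
    and "magnetic_potential G \<alpha>"
  shows "(even n \<longrightarrow> 2 \<le> eigval (n div 2 + 1) G \<alpha> \<and> 2 < eigval (n div 2 + 2) G \<alpha>)
       \<and> (odd n \<longrightarrow> eigval ((n + 1) div 2 + 1) G \<alpha> > 2)"
proof -
  interpret graph G by fact
  obtain v a where "bij_betw v {..<n} (verts G)" "\<And>i. v (i + n) = v i"
    "\<And>i. a i \<in> arcs G" "\<And>i. tail G (a i) = v i" "\<And>i. head G (a i) = v (Suc i)"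
    using hamiltonian_enumeration [OF finite_verts \<open>hamiltonian G\<close>] assms(2) by metis
  then interpret hamiltonian_magnetic_graph G \<alpha> v a
    using assms by unfold_locales simp_all
  show ?thesis
  proof (intro conjI impI)
    assume "even n"
    then show "2 \<le> eigval (n div 2 + 1) G \<alpha>"
      using eigval_ge_2 assms(2) by simp
    \<comment> \<open>For even \<open>n\<close> the index set has \<open>n div 2 - 1\<close>
      elements, which makes \<open>n div 2 + 2\<close> the first admissible \<open>k\<close>; it is
      at most \<open>n\<close> because \<open>n > 3\<close>.\<close>
    show "2 < eigval (n div 2 + 2) G \<alpha>"
      by (rule eigval_gt_2) (use \<open>even n\<close> assms(2,3) in \<open>auto elim!: evenE\<close>)
  next
    assume "odd n"
    then show "2 < eigval ((n + 1) div 2 + 1) G \<alpha>"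
      by (intro eigval_gt_2) (use assms(2,3) in \<open>auto elim!: oddE\<close>)
  qed
qed

end
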